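(* Let $\omega\in\{3,4,5,\dots\}$, let $m\geqslant0$ be an integer, and let $r'=\left\lfloor\frac{m+2}{\omega+1}\right\rfloor$. Then $$g_{\omega,m}(0)<\cdots<g_{\omega,m}(r'-1)\leqslant g_{\omega,m}(r')>g_{\omega,m}(r'+1)>\cdots>g_{\omega,m}(m),$$ with equality $g_{\omega,m}(r'-1)=g_{\omega,m}(r')$ if and only if $\omega=m+1$.
   Context: For integers $0\leqslant r\leqslant m$, $s_m(r)=\sum_{i=0}^r\binom{m}{i}$ and $g_{\omega,m}(r)=\omega^{-r}s_m(r)$. The domain is extended by $g_{\omega,m}(-1)=0$ and $g_{\omega,m}(m+1)=g_{\omega,m}(m)/\omega$. In the increasing part of the chain, the inequalities are strict between consecutive arguments up to $r'-1$, followed by the single inequality $g_{\omega,m}(r'-1)\leqslant g_{\omega,m}(r')$. *)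

theory Defs
  imports Complex_Main
begin

definition binom_sum :: "nat \<Rightarrow> nat \<Rightarrow> nat"
  where "binom_sum m r = (\<Sum>i = 0..r. m choose i)"

text \<open>The intended domain is \<open>-1 \<le> r \<le> m + 1\<close>; the first two branches are the
  extension of the function from \<open>0 \<le> r \<le> m\<close>. Values elsewhere are irrelevant.\<close>

definition g :: "real \<Rightarrow> nat \<Rightarrow> int \<Rightarrow> real"
  where "g \<omega> m r =
    (if r = -1 then 0
     else if r = int m + 1 then \<omega> powi (- int m) * real (binom_sum m m) / \<omega>
     else \<omega> powi (- r) * real (binom_sum m (nat r)))"

end

theory Submission
  imports Defs
begin

text \<open>
  Write \<open>s r\<close> for \<open>binom_sum m r\<close>. Passing from \<open>r\<close> to \<open>r + 1\<close> multiplies \<open>g\<close> by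
  \<open>s (r + 1) / (\<omega> * s r)\<close>, so everything depends on how the ratio \<open>s (r + 1) / s r\<close> compares
  with \<open>\<omega>\<close>. The key is that this ratio is known within \<open>1 / (r + 1)\<close>:
  \[ \frac{m+2}{r+1} - 1 \le \frac{s(r+1)}{s(r)} < \frac{m+3}{r+1} - 1. \]
  The lower bound (\<open>binom_sum_ratio_lower\<close>) holds for every \<open>r\<close>, with equality for \<open>r = 0\<close>
  only; the upper bound (\<open>binom_sum_ratio_upper\<close>) holds for \<open>4 * r \<le> m + 2\<close>. Since \<open>m + 2\<close> and
  \<open>m + 3\<close> are consecutive integers and \<open>\<omega>\<close> is an integer, nothing is left undecided:
  the ratio is at least \<open>\<omega>\<close> when \<open>(\<omega> + 1) * (r + 1) \<le> m + 2\<close>, that is when \<open>r + 1 \<le> r'\<close>, and it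
  is below \<open>\<omega>\<close> at \<open>r = r'\<close>, where \<open>\<omega> \<ge> 3\<close> gives \<open>4 * r' \<le> m + 2\<close>. Once the ratio has
  dropped below \<open>\<omega>\<close> it stays there (\<open>binom_sum_ratio_stays_below\<close>), which gives the decreasing
  part of the chain also for those \<open>r\<close> that the upper bound does not reach. Equality
  between \<open>g (r' - 1)\<close> and \<open>g r'\<close> needs equality both in the lower bound, so \<open>r' = 1\<close>, and
  in \<open>(\<omega> + 1) * r' \<le> m + 2\<close>, so \<open>\<omega> = m + 1\<close>.

  All three estimates rest on a three-term recurrence for \<open>s\<close>.
\<close>

section \<open>Partial sums of binomial coefficients\<close>

lemma binom_sum_0: "binom_sum m 0 = 1"
  by (simp add: binom_sum_def)

lemma binom_sum_Suc: "binom_sum m (Suc r) = binom_sum m r + (m choose Suc r)"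
  by (simp add: binom_sum_def)

lemma binom_sum_pos: "binom_sum m r > 0"
  by (induction r) (simp_all add: binom_sum_0 binom_sum_Suc)

lemma binom_sum_Suc_top: "binom_sum m (Suc m) = binom_sum m m"
  by (simp add: binom_sum_Suc)

text \<open>
  This is the absorption rule \<open>(r + 2) * (m choose (r + 2)) = (m - (r + 1)) * (m choose (r + 1))\<close>
  for the successive differences of \<open>binom_sum\<close>, arranged so that no subtraction occurs.
\<close>
lemma binom_sum_recurrence:
  "(r + 2) * binom_sum m (Suc (Suc r)) + m * binom_sum m r
     = (m + 1) * binom_sum m (Suc r) + (r + 1) * binom_sum m r"
proof -
  have "(r + 2) * (m choose Suc (Suc r)) + (r + 1) * (m choose Suc r) = m * (m choose Suc r)"
  proof (cases "Suc r \<le> m")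
    case True
    have "(r + 2) * (m choose Suc (Suc r)) = (m - Suc r) * (m choose Suc r)"
      using binomial_absorb_comp[of m "Suc r"] binomial_absorption[of "Suc r" m] by simp
    then have "(r + 2) * (m choose Suc (Suc r)) + (r + 1) * (m choose Suc r)
        = (m - Suc r + (r + 1)) * (m choose Suc r)"
      by (simp only: add_mult_distrib)
    then show ?thesis
      using True by simp
  qed (simp add: binomial_eq_0)
  then show ?thesis
    by (simp add: binom_sum_Suc algebra_simps)
qed

section \<open>Bounds on the ratio of consecutive partial sums\<close>

text \<open>
  At \<open>r = 0\<close> both sides equal \<open>m + 2\<close>, and by the recurrence each step of the induction gains
  \<open>2 * binom_sum m r\<close>; hence the inequality is strict from \<open>r = 1\<close> on.
\<close>
lemma binom_sum_ratio_lower: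
  "(m + 2) * binom_sum m r \<le> (r + 1) * (binom_sum m r + binom_sum m (Suc r))"
  "r > 0 \<Longrightarrow> (m + 2) * binom_sum m r < (r + 1) * (binom_sum m r + binom_sum m (Suc r))"
proof -
  have step: "(m + 2) * binom_sum m (Suc r)
      < (Suc r + 1) * (binom_sum m (Suc r) + binom_sum m (Suc (Suc r)))"
    if "(m + 2) * binom_sum m r \<le> (r + 1) * (binom_sum m r + binom_sum m (Suc r))" for r
    using that binom_sum_recurrence[of r m] binom_sum_pos[of m r]
    by (simp add: algebra_simps)
  show weak: "(m + 2) * binom_sum m r \<le> (r + 1) * (binom_sum m r + binom_sum m (Suc r))" for r
  proof (induction r)
    case 0
    show ?case by (simp add: binom_sum_0 binom_sum_Suc)
  next
    case (Suc r)
    then show ?case using step by (simp only: less_imp_le)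
  qed
  show "(m + 2) * binom_sum m r < (r + 1) * (binom_sum m r + binom_sum m (Suc r))" if "r > 0"
    using that step[OF weak] by (cases r) simp_all
qed

text \<open>
  By the recurrence the claim for \<open>r + 1\<close> amounts to
  \<open>r * binom_sum m (r + 1) < (m - r - 1) * binom_sum m r\<close>. Multiplied by \<open>r + 1\<close>, it follows from
  the claim for \<open>r\<close> with \<open>(m - 4 * r - 1) * binom_sum m r\<close> to spare, which is where the bound
  on \<open>r\<close> comes from.
\<close>
lemma binom_sum_ratio_upper:
  assumes "4 * r \<le> m + 2"
  shows "(r + 1) * (binom_sum m r + binom_sum m (Suc r)) < (m + 3) * binom_sum m r"
  using assms
proof (induction r)
  case 0
  show ?case by (simp add: binom_sum_0 binom_sum_Suc)
next
  case (Suc r)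
  define a b c M R where "a = int (binom_sum m r)" and "b = int (binom_sum m (Suc r))"
    and "c = int (binom_sum m (Suc (Suc r)))" and "M = int m" and "R = int r"
  note defs = this
  have nonneg: "R \<ge> 0" "a > 0"
    using binom_sum_pos[of m r] by (simp_all add: defs)
  have gap: "M - 4 * R - 1 > 0"
    using Suc.prems by (simp add: defs)
  have IH: "(R + 1) * (a + b) < (M + 3) * a"
  proof -
    have "int ((r + 1) * (binom_sum m r + binom_sum m (Suc r))) < int ((m + 3) * binom_sum m r)"
      using Suc.IH Suc.prems by (intro of_nat_less_iff[THEN iffD2]) simp
    then show ?thesis
      by (simp add: defs algebra_simps)
  qed
  have rec: "(R + 2) * c + M * a = (M + 1) * b + (R + 1) * a"
    using arg_cong[OF binom_sum_recurrence[of r m], of int] by (simp add: defs algebra_simps)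
  have "(R + 1) * (R * b) \<le> R * ((M + 2 - R) * a)"
    using mult_left_mono[OF less_imp_le[OF IH] nonneg(1)] by (simp add: algebra_simps)
  also have "\<dots> < R * ((M + 2 - R) * a) + (M - 4 * R - 1) * a"
    using gap nonneg by simp
  also have "\<dots> = (R + 1) * ((M - R - 1) * a)"
    by (simp add: algebra_simps)
  finally have "R * b < (M - R - 1) * a"
    using nonneg by (simp add: mult_less_cancel_left)
  then have "(R + 2) * (b + c) < (M + 3) * b"
    using rec by (simp add: algebra_simps)
  then have "int ((Suc r + 1) * (binom_sum m (Suc r) + binom_sum m (Suc (Suc r))))
      < int ((m + 3) * binom_sum m (Suc r))"
    by (simp add: defs algebra_simps)
  then show ?case
    by (simp only: of_nat_less_iff)
qed

text \<open>
  Let \<open>d\<close> be the increment of \<open>binom_sum\<close> from \<open>r\<close> to \<open>r + 1\<close>. The hypothesis on the ratio says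
  \<open>\<omega> * d < (\<omega> - 1) * binom_sum m (r + 1)\<close>, whereas the next increment is
  \<open>(m - r - 1) / (r + 2) * d\<close>, at most \<open>\<omega> * d\<close> by the hypothesis on \<open>r\<close>.
\<close>
lemma binom_sum_ratio_stays_below:
  assumes below: "binom_sum m (Suc r) < \<omega> * binom_sum m r"
    and large: "m + 1 \<le> (\<omega> + 1) * (r + 2)"
  shows "binom_sum m (Suc (Suc r)) < \<omega> * binom_sum m (Suc r)"
proof -
  define a b c M R W where "a = int (binom_sum m r)" and "b = int (binom_sum m (Suc r))"
    and "c = int (binom_sum m (Suc (Suc r)))" and "M = int m" and "R = int r" and "W = int \<omega>"
  note defs = this
  have "R \<ge> 0" "b - a \<ge> 0"
    by (simp_all add: defs binom_sum_Suc)
  have b: "b < W * a"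
    using below unfolding defs by (simp flip: of_nat_less_iff[where 'a = int])
  have l: "M + 1 \<le> (W + 1) * (R + 2)"
  proof -
    have "int (m + 1) \<le> int ((\<omega> + 1) * (r + 2))"
      using large by (simp only: of_nat_le_iff)
    then show ?thesis
      by (simp add: defs algebra_simps)
  qed
  have "(R + 2) * c + M * a = (M + 1) * b + (R + 1) * a"
    using arg_cong[OF binom_sum_recurrence[of r m], of int] by (simp add: defs algebra_simps)
  then have "(R + 2) * (c - b) = (M - R - 1) * (b - a)"
    by (simp add: algebra_simps)
  also have "\<dots> \<le> ((R + 2) * W) * (b - a)"
    using l \<open>b - a \<ge> 0\<close> by (intro mult_right_mono) (simp_all add: algebra_simps)
  also have "\<dots> = (R + 2) * (W * (b - a))"
    by simp
  also have "\<dots> < (R + 2) * ((W - 1) * b)"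
    using b \<open>R \<ge> 0\<close> by (intro mult_strict_left_mono) (simp_all add: algebra_simps)
  finally have "c - b < (W - 1) * b"
    using \<open>R \<ge> 0\<close> by (simp add: mult_less_cancel_left)
  then have "c < W * b"
    by (simp add: algebra_simps)
  then have "int (binom_sum m (Suc (Suc r))) < int (\<omega> * binom_sum m (Suc r))"
    by (simp add: defs)
  then show ?thesis
    by (simp only: of_nat_less_iff)
qed

section \<open>Comparing the ratio with an integer\<close>

text \<open>
  With \<open>s = binom_sum m\<close>, the chain
  \<open>(\<omega> + 1) * (r + 1) * s r \<le> (m + 2) * s r \<le> (r + 1) * (s r + s (r + 1))\<close> gives
  \<open>\<omega> * s r \<le> s (r + 1)\<close>. The first step is an equality only for \<open>(\<omega> + 1) * (r + 1) = m + 2\<close> and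
  the second only for \<open>r = 0\<close>; together these force \<open>\<omega> = m + 1\<close>.
\<close>
lemma binom_sum_Suc_ge:
  assumes "(\<omega> + 1) * (r + 1) \<le> m + 2"
  shows "\<omega> * binom_sum m r \<le> binom_sum m (Suc r)"
    and "r > 0 \<or> (\<omega> + 1) * (r + 1) < m + 2 \<Longrightarrow> \<omega> * binom_sum m r < binom_sum m (Suc r)"
proof -
  let ?s = "binom_sum m"
  have first: "(\<omega> + 1) * (r + 1) * ?s r \<le> (m + 2) * ?s r"
    using assms by (rule mult_le_mono1)
  have "(r + 1) * ((\<omega> + 1) * ?s r) \<le> (r + 1) * (?s r + ?s (Suc r))"
    using first binom_sum_ratio_lower(1)[of m r] by (simp only: ac_simps)
  then show "\<omega> * ?s r \<le> ?s (Suc r)"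
    by (subst (asm) mult_le_cancel1) simp
  assume strict: "r > 0 \<or> (\<omega> + 1) * (r + 1) < m + 2"
  have "(\<omega> + 1) * (r + 1) * ?s r < (r + 1) * (?s r + ?s (Suc r))"
    using strict
  proof
    assume "r > 0"
    show ?thesis
      using first binom_sum_ratio_lower(2)[OF \<open>r > 0\<close>, of m] by (rule le_less_trans)
  next
    assume "(\<omega> + 1) * (r + 1) < m + 2"
    then have "(\<omega> + 1) * (r + 1) * ?s r < (m + 2) * ?s r"
      using binom_sum_pos by (rule mult_less_mono1)
    then show ?thesis
      using binom_sum_ratio_lower(1)[of m r] by (rule less_le_trans)
  qed
  then have "(r + 1) * ((\<omega> + 1) * ?s r) < (r + 1) * (?s r + ?s (Suc r))"
    by (simp only: ac_simps)
  then show "\<omega> * ?s r < ?s (Suc r)"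
    by (subst (asm) mult_less_cancel1) simp
qed

text \<open>
  The start of the induction is \<open>(r + 1) * (s r + s (r + 1)) < (m + 3) * s r \<le>
  (\<omega> + 1) * (r + 1) * s r\<close> with \<open>s = binom_sum m\<close>, at an \<open>r\<close> small enough for the upper bound on
  the ratio.
\<close>
lemma binom_sum_Suc_less:
  assumes "4 * r\<^sub>0 \<le> m + 2" and "m + 2 < (\<omega> + 1) * (r\<^sub>0 + 1)" and "r\<^sub>0 \<le> r"
  shows "binom_sum m (Suc r) < \<omega> * binom_sum m r"
  using \<open>r\<^sub>0 \<le> r\<close>
proof (induction r rule: dec_induct)
  case base
  let ?s = "binom_sum m"
  note binom_sum_ratio_upper[OF assms(1)]
  also have "(m + 3) * ?s r\<^sub>0 \<le> (\<omega> + 1) * (r\<^sub>0 + 1) * ?s r\<^sub>0"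
    using assms(2) by (intro mult_le_mono1) simp
  finally have "(r\<^sub>0 + 1) * (?s r\<^sub>0 + ?s (Suc r\<^sub>0)) < (r\<^sub>0 + 1) * ((\<omega> + 1) * ?s r\<^sub>0)"
    by (simp only: ac_simps)
  then show ?case
    by (subst (asm) mult_less_cancel1) simp
next
  case (step r)
  have "(\<omega> + 1) * (r\<^sub>0 + 1) \<le> (\<omega> + 1) * (r + 2)"
    using step.hyps by (intro mult_le_mono2) simp
  then show ?case
    using assms(2) step.IH by (intro binom_sum_ratio_stays_below) simp_all
qed

section \<open>The peak of the weighted partial sums\<close>

text \<open>
  The value prescribed at \<open>m + 1\<close> is the one that the formula for \<open>0 \<le> r \<le> m\<close> would give,
  because \<open>binom_sum m (m + 1) = binom_sum m m\<close>.
\<close>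
lemma g_of_nat:
  assumes "r \<le> Suc m"
  shows "g \<omega> m (int r) = real (binom_sum m r) / \<omega> ^ r"
proof (cases "r = Suc m")
  case True
  then show ?thesis
    by (simp add: g_def binom_sum_Suc_top power_int_minus power_int_of_nat field_simps)
next
  case False
  then show ?thesis
    by (simp add: g_def power_int_minus power_int_of_nat field_simps)
qed

lemma g_succ_diff:
  assumes "r \<le> m" and "\<omega> > 0"
  shows "g (real \<omega>) m (int r + 1) - g (real \<omega>) m (int r)
    = (real (binom_sum m (Suc r)) - real (\<omega> * binom_sum m r)) / real \<omega> ^ Suc r"
  using g_of_nat[of r m "real \<omega>"] g_of_nat[of "Suc r" m "real \<omega>"] assms
  by (simp add: field_simps)

lemma g_succ_compare:
  assumes "r \<le> m" and "\<omega> > 0"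
  shows "g (real \<omega>) m (int r) < g (real \<omega>) m (int r + 1)
      \<longleftrightarrow> \<omega> * binom_sum m r < binom_sum m (Suc r)"
    and "g (real \<omega>) m (int r + 1) < g (real \<omega>) m (int r)
      \<longleftrightarrow> binom_sum m (Suc r) < \<omega> * binom_sum m r"
proof -
  have pos: "real \<omega> ^ Suc r > 0"
    using assms(2) by simp
  have "g (real \<omega>) m (int r) < g (real \<omega>) m (int r + 1)
      \<longleftrightarrow> 0 < (real (binom_sum m (Suc r)) - real (\<omega> * binom_sum m r)) / real \<omega> ^ Suc r"
    unfolding g_succ_diff[OF assms, symmetric] by simp
  also have "\<dots> \<longleftrightarrow> real (\<omega> * binom_sum m r) < real (binom_sum m (Suc r))"
    by (subst pos_less_divide_eq[OF pos]) simp
  finally show "g (real \<omega>) m (int r) < g (real \<omega>) m (int r + 1)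
      \<longleftrightarrow> \<omega> * binom_sum m r < binom_sum m (Suc r)"
    by (simp only: of_nat_less_iff)
  have "g (real \<omega>) m (int r + 1) < g (real \<omega>) m (int r)
      \<longleftrightarrow> (real (binom_sum m (Suc r)) - real (\<omega> * binom_sum m r)) / real \<omega> ^ Suc r < 0"
    unfolding g_succ_diff[OF assms, symmetric] by simp
  also have "\<dots> \<longleftrightarrow> real (binom_sum m (Suc r)) < real (\<omega> * binom_sum m r)"
    by (subst pos_divide_less_eq[OF pos]) simp
  finally show "g (real \<omega>) m (int r + 1) < g (real \<omega>) m (int r)
      \<longleftrightarrow> binom_sum m (Suc r) < \<omega> * binom_sum m r"
    by (simp only: of_nat_less_iff)
qed

theorem theorem1p4:
  fixes \<omega> m :: nat and r' :: int
  assumes "\<omega> \<ge> 3"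
    and "r' = \<lfloor>(real m + 2) / (real \<omega> + 1)\<rfloor>"
  shows "(\<forall>r. 0 \<le> r \<and> r + 1 \<le> r' - 1 \<longrightarrow> g \<omega> m r < g \<omega> m (r + 1))
    \<and> g \<omega> m (r' - 1) \<le> g \<omega> m r'
    \<and> g \<omega> m r' > g \<omega> m (r' + 1)
    \<and> (\<forall>r. r' + 1 \<le> r \<and> r + 1 \<le> int m \<longrightarrow> g \<omega> m r > g \<omega> m (r + 1))
    \<and> (g \<omega> m (r' - 1) = g \<omega> m r' \<longleftrightarrow> \<omega> = m + 1)"
proof -
  define q where "q = (m + 2) div (\<omega> + 1)"
  have r': "r' = int q"
    using assms(2) floor_divide_of_nat_eq[of "m + 2" "\<omega> + 1", where 'a = real]
    by (simp add: q_def add_ac)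
  have "\<omega> > 0"
    using assms(1) by simp
  have q_le: "(\<omega> + 1) * q \<le> m + 2"
    unfolding q_def by (rule times_div_less_eq_dividend)
  have q_gt: "m + 2 < (\<omega> + 1) * (q + 1)"
    unfolding q_def using dividend_less_times_div[of "\<omega> + 1" "m + 2"] by simp
  have "4 * q \<le> (\<omega> + 1) * q"
    using assms(1) by (intro mult_le_mono1) simp
  then have q4: "4 * q \<le> m + 2"
    using q_le by (rule le_trans)
  have increasing: "g \<omega> m r < g \<omega> m (r + 1)" if r: "0 \<le> r \<and> r + 1 \<le> r' - 1" for r
  proof -
    obtain k where k: "r = int k"
      using r nonneg_int_cases by blast
    have "k + 2 \<le> q"
      using r unfolding k r' by simp
    then have "(\<omega> + 1) * (k + 1) < (\<omega> + 1) * q"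
      by (intro mult_strict_left_mono) simp_all
    then have "(\<omega> + 1) * (k + 1) < m + 2"
      using q_le by simp
    then have "\<omega> * binom_sum m k < binom_sum m (Suc k)"
      by (intro binom_sum_Suc_ge(2)) simp_all
    then show ?thesis
      using g_succ_compare(1)[of k m \<omega>] \<open>\<omega> > 0\<close> \<open>k + 2 \<le> q\<close> q4 by (simp add: k)
  qed
  have decreasing: "g \<omega> m (r + 1) < g \<omega> m r" if r: "r' \<le> r" "r \<le> int m" for r
  proof -
    obtain k where k: "r = int k"
      using r r' nonneg_int_cases[of r] by fastforce
    have "binom_sum m (Suc k) < \<omega> * binom_sum m k"
      using q4 q_gt r by (intro binom_sum_Suc_less[of q]) (simp_all add: k r')
    then show ?thesis
      using g_succ_compare(2)[of k m \<omega>] \<open>\<omega> > 0\<close> r by (simp add: k)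
  qed
  have peak: "g \<omega> m (r' - 1) \<le> g \<omega> m r' \<and> (g \<omega> m (r' - 1) = g \<omega> m r' \<longleftrightarrow> \<omega> = m + 1)"
  proof (cases q)
    case 0
    \<comment> \<open>Here \<open>r' - 1 = -1\<close>, where \<open>g\<close> vanishes, and \<open>m + 2 < \<omega> + 1\<close>.\<close>
    have "g \<omega> m (r' - 1) = 0"
      by (simp add: r' 0 g_def)
    moreover have "g \<omega> m r' = 1"
      using g_of_nat[of 0 m "real \<omega>"] by (simp add: r' 0 binom_sum_0)
    moreover have "\<omega> \<noteq> m + 1"
      using q_gt 0 by simp
    ultimately show ?thesis by simp
  next
    case (Suc k)
    have "k \<le> m"
      using q4 Suc by simp
    note cmp = g_succ_compare[OF \<open>k \<le> m\<close> \<open>\<omega> > 0\<close>]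
    have r'k: "r' - 1 = int k" "r' = int k + 1"
      by (simp_all add: r' Suc)
    have k_le: "(\<omega> + 1) * (k + 1) \<le> m + 2"
      using q_le Suc by simp
    have "g \<omega> m (int k) \<le> g \<omega> m (int k + 1)"
      using binom_sum_Suc_ge(1)[OF k_le] cmp(2) by linarith
    moreover have "g \<omega> m (int k) = g \<omega> m (int k + 1) \<longleftrightarrow> \<omega> = m + 1"
    proof
      assume "g \<omega> m (int k) = g \<omega> m (int k + 1)"
      then have "\<not> \<omega> * binom_sum m k < binom_sum m (Suc k)"
        using cmp(1) by simp
      then have "\<not> (k > 0 \<or> (\<omega> + 1) * (k + 1) < m + 2)"
        using binom_sum_Suc_ge(2)[OF k_le] by blast
      then show "\<omega> = m + 1"
        using k_le by auto
    next
      assume \<omega>: "\<omega> = m + 1"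
      then have "k = 0"
        using k_le by simp
      then show "g \<omega> m (int k) = g \<omega> m (int k + 1)"
        using cmp \<omega> by (simp add: binom_sum_0 binom_sum_Suc)
    qed
    ultimately show ?thesis
      unfolding r'k(1) r'k(2) by simp
  qed
  have "r' \<le> int m"
    using q4 by (simp add: r')
  then show ?thesis
    using increasing decreasing peak by simp
qed

end
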